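(* Let $X$ be an Archimedean partially ordered vector space with order unit $u$, and let $B$ be a band in $X$. Then the carrier of $\Phi(B)^{dd}$ (disjoint complements taken in $C(\overline{\Lambda})$) is given by $$\mathrm{car}(\Phi(B)^{dd})=\mathrm{int}\bigl(\overline{\mathrm{car}(B)}\bigr),$$ and $\Phi(B)^{dd}$ is the largest ideal of $C(\overline{\Lambda})$ with carrier $\mathrm{int}\bigl(\overline{\mathrm{car}(B)}\bigr)$.
   Context: Let $X$ be a real vector space partially ordered by a cone $K$ (so $K$ is closed under addition and multiplication by nonnegative scalars, $K\cap(-K)=\{0\}$, and $x\le y$ iff $y-x\in K$). $X$ is Archimedean if $nx\le y$ for all $n\in\mathbb{N}$ implies $x\le 0$. An element $u\in K$ is an order unit if for each $x\in X$ there is $\alpha\ge 0$ with $-\alpha u\le x\le\alpha u$. Put $\|x\|_u=\inf\{\alpha>0\colon -\alpha u\le x\le \alpha u\}$, let $X'$ be the norm dual of $(X,\|\cdot\|_u)$ with its weak* topology, $K'=\{\varphi\in X'\colon \varphi(K)\subseteq[0,\infty)\}$, $\Sigma=\{\varphi\in K'\colon\varphi(u)=1\}$, $\Lambda$ the set of extreme points of $\Sigma$, and $\overline{\Lambda}$ the weak* closure of $\Lambda$, a compact Hausdorff space. The map $\Phi\colon X\to C(\overline{\Lambda})$ is $(\Phi(x))(\varphi)=\varphi(x)$. In a partially ordered vector space $W$ (here $W=X$ or $W=C(\overline{\Lambda})$ with pointwise order), $M^u$ is the set of upper bounds of $M\subseteq W$; $x\perp y$ (disjoint) means $\{x+y,-x-y\}^u=\{x-y,-x+y\}^u$;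 $M^d=\{y\in W\colon x\perp y\text{ for all }x\in M\}$ and $M^{dd}=(M^d)^d$. A linear subspace $B$ of $W$ is a band if $B^{dd}=B$. In $C(\overline{\Lambda})$ disjointness of $f,g$ is the usual one: at every point $f$ or $g$ vanishes. For $S\subseteq C(\overline{\Lambda})$, $\mathrm{car}(S)=\{\varphi\in\overline{\Lambda}\colon s(\varphi)\ne0\text{ for some }s\in S\}$; for $B\subseteq X$, $\mathrm{car}(B):=\mathrm{car}(\Phi(B))=\{\varphi\in\overline{\Lambda}\colon\varphi(b)\neq0\text{ for some }b\in B\}$. Closure and interior $\mathrm{int}$ are taken in $\overline{\Lambda}$ with the weak* topology. *)

theory Defs
  imports "HOL-Analysis.Analysis" "HOL-Library.Function_Algebras"
begin

section \<open>Pointwise ordered vector space structure on functions\<close>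

instantiation "fun" :: (type, real_vector) real_vector
begin

definition scaleR_fun_def: "r *\<^sub>R f = (\<lambda>x. r *\<^sub>R f x)"

instance
  by standard (auto simp: scaleR_fun_def fun_eq_iff scaleR_add_right scaleR_add_left)

end

instance "fun" :: (type, ordered_real_vector) ordered_real_vector
  by standard (auto simp: scaleR_fun_def le_fun_def intro: scaleR_left_mono scaleR_right_mono)


section \<open>Disjointness and bands\<close>

text \<open>
  A partially ordered vector space is given as a linear subspace \<open>W\<close> of a type of class
  \<^class>\<open>ordered_real_vector\<close>, with the induced order. Upper bounds, and hence disjointness,
  are taken within \<open>W\<close>.
\<close>

definition upper_bounds :: "'w::ordered_real_vector set \<Rightarrow> 'w set \<Rightarrow> 'w set" where
  "upper_bounds W M = {z \<in> W. \<forall>m\<in>M. m \<le> z}"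

definition disjoint_in :: "'w::ordered_real_vector set \<Rightarrow> 'w \<Rightarrow> 'w \<Rightarrow> bool" where
  "disjoint_in W x y \<longleftrightarrow>
     upper_bounds W {x + y, - x - y} = upper_bounds W {x - y, - x + y}"

definition disj_compl :: "'w::ordered_real_vector set \<Rightarrow> 'w set \<Rightarrow> 'w set" where
  "disj_compl W M = {y \<in> W. \<forall>x\<in>M. disjoint_in W x y}"

definition band_in :: "'w::ordered_real_vector set \<Rightarrow> 'w set \<Rightarrow> bool" where
  "band_in W B \<longleftrightarrow> subspace B \<and> B \<subseteq> W \<and> disj_compl W (disj_compl W B) = B"


section \<open>Order unit, norm dual and extreme states\<close>

definition order_unit :: "'a::ordered_real_vector \<Rightarrow> bool" where
  "order_unit u \<longleftrightarrow>
     0 \<le> u \<and> (\<forall>x. \<exists>\<alpha>\<ge>0. - (\<alpha> *\<^sub>R u) \<le> x \<and> x \<le> \<alpha> *\<^sub>R u)"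

definition unit_norm :: "'a::ordered_real_vector \<Rightarrow> 'a \<Rightarrow> real" where
  "unit_norm u x = Inf {\<alpha>. \<alpha> > 0 \<and> - (\<alpha> *\<^sub>R u) \<le> x \<and> x \<le> \<alpha> *\<^sub>R u}"

definition norm_dual :: "'a::ordered_real_vector \<Rightarrow> ('a \<Rightarrow> real) set" where
  "norm_dual u = {\<phi>. linear \<phi> \<and> (\<exists>C. \<forall>x. \<bar>\<phi> x\<bar> \<le> C * unit_norm u x)}"

text \<open>The weak* topology is the topology of pointwise convergence, i.e. the trace of the product
  topology on \<open>X \<Rightarrow> \<real>\<close>.\<close>

definition weak_star :: "'a::ordered_real_vector \<Rightarrow> ('a \<Rightarrow> real) topology" where
  "weak_star u = subtopology (powertop_real UNIV) (norm_dual u)"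

definition dual_cone :: "'a::ordered_real_vector \<Rightarrow> ('a \<Rightarrow> real) set" where
  "dual_cone u = {\<phi> \<in> norm_dual u. \<forall>x\<ge>0. \<phi> x \<ge> 0}"

definition states :: "'a::ordered_real_vector \<Rightarrow> ('a \<Rightarrow> real) set" where
  "states u = {\<phi> \<in> dual_cone u. \<phi> u = 1}"

definition extreme_states :: "'a::ordered_real_vector \<Rightarrow> ('a \<Rightarrow> real) set" where
  "extreme_states u = {\<phi>. \<phi> extreme_point_of states u}"

definition Lambda_bar :: "'a::ordered_real_vector \<Rightarrow> ('a \<Rightarrow> real) set" where
  "Lambda_bar u = weak_star u closure_of extreme_states u"

definition Lambda_top :: "'a::ordered_real_vector \<Rightarrow> ('a \<Rightarrow> real) topology" where
  "Lambda_top u = subtopology (weak_star u) (Lambda_bar u)"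


section \<open>The space of continuous functions on the closure of the extreme states\<close>

text \<open>
  A continuous function on \<open>Lambda_bar u\<close> is represented by its unique extension to the whole type
  that vanishes off \<open>Lambda_bar u\<close>. The pointwise vector space operations and the pointwise order of
  the function type then restrict to those of \<open>C(Lambda_bar u)\<close>.
\<close>

definition C_Lambda :: "'a::ordered_real_vector \<Rightarrow> (('a \<Rightarrow> real) \<Rightarrow> real) set" where
  "C_Lambda u = {f. continuous_map (Lambda_top u) euclideanreal f \<and>
                    (\<forall>\<phi>. \<phi> \<notin> Lambda_bar u \<longrightarrow> f \<phi> = 0)}"

definition Phi :: "'a::ordered_real_vector \<Rightarrow> 'a \<Rightarrow> ('a \<Rightarrow> real) \<Rightarrow> real" where
  "Phi u x = (\<lambda>\<phi>. if \<phi> \<in> Lambda_bar u then \<phi> x else 0)"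

definition carrier_of ::
    "'a::ordered_real_vector \<Rightarrow> (('a \<Rightarrow> real) \<Rightarrow> real) set \<Rightarrow> ('a \<Rightarrow> real) set" where
  "carrier_of u S = {\<phi> \<in> Lambda_bar u. \<exists>s\<in>S. s \<phi> \<noteq> 0}"

text \<open>Ideals are order ideals of the vector lattice \<open>C(Lambda_bar u)\<close>: solid linear subspaces.\<close>

definition ideal_C :: "'a::ordered_real_vector \<Rightarrow> (('a \<Rightarrow> real) \<Rightarrow> real) set \<Rightarrow> bool" where
  "ideal_C u I \<longleftrightarrow> subspace I \<and> I \<subseteq> C_Lambda u \<and>
     (\<forall>g\<in>I. \<forall>f\<in>C_Lambda u. (\<forall>\<phi>\<in>Lambda_bar u. \<bar>f \<phi>\<bar> \<le> \<bar>g \<phi>\<bar>) \<longrightarrow> f \<in> I)"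

lemma subspace_C_Lambda: "subspace (C_Lambda u)"
  by (auto simp: subspace_def C_Lambda_def scaleR_fun_def plus_fun_def zero_fun_def
      intro!: continuous_intros)

lemma Phi_in_C_Lambda: "Phi u x \<in> C_Lambda u"
proof -
  have "continuous_map (Lambda_top u) euclideanreal (\<lambda>\<phi>. \<phi> x)"
    unfolding Lambda_top_def weak_star_def
    by (intro continuous_map_from_subtopology continuous_map_product_projection) simp
  then have "continuous_map (Lambda_top u) euclideanreal (Phi u x)"
    by (rule continuous_map_eq) (auto simp: Phi_def Lambda_top_def)
  then show ?thesis
    by (simp add: C_Lambda_def Phi_def)
qed

text \<open>In \<open>C(Lambda_bar u)\<close> disjointness is the usual one.\<close>

lemma disjoint_in_C_Lambda_iff:
  assumes f: "f \<in> C_Lambda u" and g: "g \<in> C_Lambda u"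
  shows "disjoint_in (C_Lambda u) f g \<longleftrightarrow> (\<forall>\<phi>\<in>Lambda_bar u. f \<phi> = 0 \<or> g \<phi> = 0)"
proof
  assume d: "disjoint_in (C_Lambda u) f g"
  have C: "(\<lambda>\<phi>. \<bar>f \<phi> + g \<phi>\<bar>) \<in> C_Lambda u" "(\<lambda>\<phi>. \<bar>f \<phi> - g \<phi>\<bar>) \<in> C_Lambda u"
    using f g by (auto simp: C_Lambda_def intro!: continuous_intros)
  have "(\<lambda>\<phi>. \<bar>f \<phi> + g \<phi>\<bar>) \<in> upper_bounds (C_Lambda u) {f + g, - f - g}"
    "(\<lambda>\<phi>. \<bar>f \<phi> - g \<phi>\<bar>) \<in> upper_bounds (C_Lambda u) {f - g, - f + g}"
    using C by (auto simp: upper_bounds_def le_fun_def)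
  then have "(\<lambda>\<phi>. \<bar>f \<phi> + g \<phi>\<bar>) \<in> upper_bounds (C_Lambda u) {f - g, - f + g}"
    "(\<lambda>\<phi>. \<bar>f \<phi> - g \<phi>\<bar>) \<in> upper_bounds (C_Lambda u) {f + g, - f - g}"
    using d by (simp_all add: disjoint_in_def)
  then have *: "f \<phi> - g \<phi> \<le> \<bar>f \<phi> + g \<phi>\<bar>" "- f \<phi> + g \<phi> \<le> \<bar>f \<phi> + g \<phi>\<bar>"
    "f \<phi> + g \<phi> \<le> \<bar>f \<phi> - g \<phi>\<bar>" "- f \<phi> - g \<phi> \<le> \<bar>f \<phi> - g \<phi>\<bar>" for \<phi>
    by (auto simp: upper_bounds_def le_fun_def)
  show "\<forall>\<phi>\<in>Lambda_bar u. f \<phi> = 0 \<or> g \<phi> = 0"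
  proof
    fix \<phi>
    show "f \<phi> = 0 \<or> g \<phi> = 0"
      using *[of \<phi>] by linarith
  qed
next
  assume "\<forall>\<phi>\<in>Lambda_bar u. f \<phi> = 0 \<or> g \<phi> = 0"
  then have *: "f \<phi> = 0 \<or> g \<phi> = 0" for \<phi>
    using f by (cases "\<phi> \<in> Lambda_bar u") (auto simp: C_Lambda_def)
  have "(f \<phi> + g \<phi> \<le> h \<phi> \<and> - f \<phi> - g \<phi> \<le> h \<phi>) \<longleftrightarrow>
      (f \<phi> - g \<phi> \<le> h \<phi> \<and> - f \<phi> + g \<phi> \<le> h \<phi>)" for h :: "('a \<Rightarrow> real) \<Rightarrow> real" and \<phi>
    using *[of \<phi>] by auto
  then have "(\<forall>\<phi>. f \<phi> + g \<phi> \<le> h \<phi>) \<and> (\<forall>\<phi>. - f \<phi> - g \<phi> \<le> h \<phi>) \<longleftrightarrow>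
      (\<forall>\<phi>. f \<phi> - g \<phi> \<le> h \<phi>) \<and> (\<forall>\<phi>. - f \<phi> + g \<phi> \<le> h \<phi>)" for h :: "('a \<Rightarrow> real) \<Rightarrow> real"
    by blast
  then show "disjoint_in (C_Lambda u) f g"
    by (auto simp: disjoint_in_def upper_bounds_def le_fun_def)
qed

end

theory Submission
  imports Defs
begin

text \<open>
  By complete regularity, points outside a closed set \<open>C\<close> are detected by continuous functions
  vanishing on \<open>C\<close>. So for a set \<open>S\<close> of continuous functions whose carrier has closure \<open>K\<close>, the
  complement \<open>S\<^sup>d\<close> consists of the functions vanishing on \<open>K\<close> and has carrier the complement of \<open>K\<close>.
  Applying this twice, \<open>S\<^sup>d\<^sup>d\<close> consists of the functions vanishing off the interior of \<open>K\<close>.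
\<close>

lemma topspace_Lambda_top: "topspace (Lambda_top u) = Lambda_bar u"
  unfolding Lambda_top_def Lambda_bar_def
  by (simp add: closure_of_subset_topspace inf.absorb2)

text \<open>The weak* topology is the trace of a power of the real line, and complete regularity
  passes from the line to products and subspaces.\<close>

lemma completely_regular_space_Lambda_top: "completely_regular_space (Lambda_top u)"
  unfolding Lambda_top_def weak_star_def
  by (intro completely_regular_space_subtopology)
    (simp add: completely_regular_space_product_topology
      metrizable_imp_completely_regular_space metrizable_space_euclidean)

lemma C_Lambda_separates:
  assumes C: "closedin (Lambda_top u) C" and \<phi>: "\<phi> \<in> Lambda_bar u - C"
  obtains f where "f \<in> C_Lambda u" "\<And>\<psi>. \<psi> \<in> C \<Longrightarrow> f \<psi> = 0" "f \<phi> \<noteq> 0"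
proof -
  obtain g :: "('a \<Rightarrow> real) \<Rightarrow> real" where
    g: "continuous_map (Lambda_top u) euclideanreal g" "g \<phi> = 0" "g ` C \<subseteq> {1}"
    using completely_regular_space_Lambda_top[of u] C \<phi>
    unfolding completely_regular_space_def topspace_Lambda_top continuous_map_in_subtopology
    by meson
  \<comment> \<open>Complete regularity yields 0 at the point and 1 on \<open>C\<close>;
    \<open>1 - g\<close> swaps these values. The value 0 off \<open>Lambda_bar u\<close> is the
    convention of \<open>C_Lambda\<close>.\<close>
  define f where "f \<psi> = (if \<psi> \<in> Lambda_bar u then 1 - g \<psi> else 0)" for \<psi>
  have "continuous_map (Lambda_top u) euclideanreal (\<lambda>\<psi>. 1 - g \<psi>)"
    using g(1) by (intro continuous_intros)
  then have "continuous_map (Lambda_top u) euclideanreal f"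
    by (rule continuous_map_eq) (simp add: f_def topspace_Lambda_top)
  then have "f \<in> C_Lambda u"
    by (simp add: C_Lambda_def f_def)
  moreover have "f \<psi> = 0" if "\<psi> \<in> C" for \<psi>
    using that g(3) by (auto simp: f_def)
  moreover have "f \<phi> \<noteq> 0"
    using \<phi> g(2) by (simp add: f_def)
  ultimately show ?thesis
    using that by blast
qed

lemma closedin_zeros_C_Lambda:
  assumes "f \<in> C_Lambda u"
  shows "closedin (Lambda_top u) {\<phi> \<in> Lambda_bar u. f \<phi> = 0}"
  using closedin_continuous_map_preimage[of "Lambda_top u" euclideanreal f "{0}"] assms
  by (simp add: C_Lambda_def topspace_Lambda_top)

text \<open>Pointwise disjointness from every member of \<open>S\<close> means vanishing on the
  carrier. Zero sets of continuous functions are closed, so this extends to the closure, a closed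
  set to which \<open>carrier_of_vanishing\<close> applies.\<close>

lemma disj_compl_C_Lambda:
  assumes S: "S \<subseteq> C_Lambda u"
  shows "disj_compl (C_Lambda u) S =
    {f \<in> C_Lambda u. \<forall>\<phi> \<in> Lambda_top u closure_of carrier_of u S. f \<phi> = 0}"
proof -
  have "disj_compl (C_Lambda u) S = {f \<in> C_Lambda u. \<forall>\<phi> \<in> carrier_of u S. f \<phi> = 0}"
    using S unfolding disj_compl_def carrier_of_def
    by (simp add: disjoint_in_C_Lambda_iff subset_iff cong: conj_cong) blast
  also have "\<dots> = {f \<in> C_Lambda u. \<forall>\<phi> \<in> Lambda_top u closure_of carrier_of u S. f \<phi> = 0}"
  proof (intro Collect_cong conj_cong refl iffI)
    fix f assume f: "f \<in> C_Lambda u" and "\<forall>\<phi> \<in> carrier_of u S. f \<phi> = 0"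
    then have "carrier_of u S \<subseteq> {\<phi> \<in> Lambda_bar u. f \<phi> = 0}"
      by (auto simp: carrier_of_def)
    then have "Lambda_top u closure_of carrier_of u S \<subseteq> {\<phi> \<in> Lambda_bar u. f \<phi> = 0}"
      using closedin_zeros_C_Lambda[OF f] by (rule closure_of_minimal)
    then show "\<forall>\<phi> \<in> Lambda_top u closure_of carrier_of u S. f \<phi> = 0"
      by blast
  next
    fix f assume *: "\<forall>\<phi> \<in> Lambda_top u closure_of carrier_of u S. f \<phi> = 0"
    have "carrier_of u S \<subseteq> Lambda_top u closure_of carrier_of u S"
      by (rule closure_of_subset) (auto simp: carrier_of_def topspace_Lambda_top)
    then show "\<forall>\<phi> \<in> carrier_of u S. f \<phi> = 0"
      using * by blast
  qed
  finally show ?thesis .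
qed

text \<open>Separation provides, for each point off \<open>C\<close>, a function vanishing on
  \<open>C\<close> but not at that point.\<close>

lemma carrier_of_vanishing:
  assumes "closedin (Lambda_top u) C"
  shows "carrier_of u {f \<in> C_Lambda u. \<forall>\<phi>\<in>C. f \<phi> = 0} = Lambda_bar u - C"
proof
  show "carrier_of u {f \<in> C_Lambda u. \<forall>\<phi>\<in>C. f \<phi> = 0} \<subseteq> Lambda_bar u - C"
    by (auto simp: carrier_of_def)
  show "Lambda_bar u - C \<subseteq> carrier_of u {f \<in> C_Lambda u. \<forall>\<phi>\<in>C. f \<phi> = 0}"
  proof
    fix \<phi> assume \<phi>: "\<phi> \<in> Lambda_bar u - C"
    obtain f where "f \<in> C_Lambda u" "\<And>\<psi>. \<psi> \<in> C \<Longrightarrow> f \<psi> = 0" "f \<phi> \<noteq> 0"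
      using C_Lambda_separates[OF assms \<phi>] by blast
    then show "\<phi> \<in> carrier_of u {f \<in> C_Lambda u. \<forall>\<phi>\<in>C. f \<phi> = 0}"
      using \<phi> by (auto simp: carrier_of_def)
  qed
qed

lemma disj_compl_disj_compl_C_Lambda:
  assumes "S \<subseteq> C_Lambda u"
  defines "U \<equiv> Lambda_top u interior_of (Lambda_top u closure_of carrier_of u S)"
  shows "disj_compl (C_Lambda u) (disj_compl (C_Lambda u) S) =
    {f \<in> C_Lambda u. \<forall>\<phi> \<in> Lambda_bar u - U. f \<phi> = 0}"
proof -
  let ?K = "Lambda_top u closure_of carrier_of u S"
  have "carrier_of u (disj_compl (C_Lambda u) S) = Lambda_bar u - ?K"
    using assms(1) by (simp add: disj_compl_C_Lambda carrier_of_vanishing)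
  \<comment> \<open>The closure of the complement of \<open>?K\<close> is the complement of its
    interior; this is where the interior enters.\<close>
  then have "Lambda_top u closure_of carrier_of u (disj_compl (C_Lambda u) S) = Lambda_bar u - U"
    using closure_of_complement[of "Lambda_top u" ?K] by (simp add: U_def topspace_Lambda_top)
  moreover have "disj_compl (C_Lambda u) S \<subseteq> C_Lambda u"
    by (auto simp: disj_compl_def)
  ultimately show ?thesis
    by (simp add: disj_compl_C_Lambda)
qed

lemma ideal_C_vanishing: "ideal_C u {f \<in> C_Lambda u. \<forall>\<phi>\<in>C. f \<phi> = 0}"
proof -
  \<comment> \<open>Domination is given on \<open>Lambda_bar u\<close> only; elsewhere
    \<open>f\<close> is 0 by convention, so \<open>C\<close> may be any set.\<close>
  have "f \<phi> = 0" if "f \<in> C_Lambda u" "g \<phi> = 0" "\<forall>\<phi>\<in>Lambda_bar u. \<bar>f \<phi>\<bar> \<le> \<bar>g \<phi>\<bar>"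
    for f g :: "('a \<Rightarrow> real) \<Rightarrow> real" and \<phi>
    using that by (cases "\<phi> \<in> Lambda_bar u") (force simp: C_Lambda_def)+
  moreover have "subspace {f \<in> C_Lambda u. \<forall>\<phi>\<in>C. f \<phi> = 0}"
    using subspace_C_Lambda[of u] by (auto simp: subspace_def scaleR_fun_def)
  ultimately show ?thesis
    unfolding ideal_C_def by blast
qed

theorem theorem22:
  fixes u :: "'a::ordered_real_vector" and B :: "'a set"
  assumes archimedean: "\<And>x y :: 'a. (\<And>n :: nat. real n *\<^sub>R x \<le> y) \<Longrightarrow> x \<le> 0"
    and unit: "order_unit u"
    and band: "band_in UNIV B"
  defines "D \<equiv> disj_compl (C_Lambda u) (disj_compl (C_Lambda u) (Phi u ` B))"
    and "U \<equiv> Lambda_top u interior_of (Lambda_top u closure_of carrier_of u (Phi u ` B))"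
  shows "carrier_of u D = U \<and>
    ideal_C u D \<and> (\<forall>I. ideal_C u I \<and> carrier_of u I = U \<longrightarrow> I \<subseteq> D)"
proof -
  have "Phi u ` B \<subseteq> C_Lambda u"
    using Phi_in_C_Lambda by blast
  then have D: "D = {f \<in> C_Lambda u. \<forall>\<phi> \<in> Lambda_bar u - U. f \<phi> = 0}"
    unfolding D_def U_def by (rule disj_compl_disj_compl_C_Lambda)
  have "openin (Lambda_top u) U"
    by (simp add: U_def)
  then have "closedin (Lambda_top u) (Lambda_bar u - U)" "U \<subseteq> Lambda_bar u"
    using openin_subset by (fastforce simp: topspace_Lambda_top openin_closedin_eq)+
  \<comment> \<open>The carrier is the double complement of \<open>U\<close> in
    \<open>Lambda_bar u\<close>, hence \<open>U\<close> itself.\<close>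
  then have "carrier_of u D = U"
    unfolding D by (simp add: carrier_of_vanishing double_diff)
  moreover have "ideal_C u D"
    unfolding D by (rule ideal_C_vanishing)
  \<comment> \<open>A member of \<open>I\<close> that is nonzero at a point of
    \<open>Lambda_bar u - U\<close> would put that point into the carrier of
    \<open>I\<close>.\<close>
  moreover have "I \<subseteq> D" if "ideal_C u I" "carrier_of u I = U" for I
    using that unfolding D ideal_C_def carrier_of_def by blast
  ultimately show ?thesis
    by blast
qed

end
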